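(* Let $LB\ge 0$ be a lower bound on the optimal objective function value of (PC2). Then $\mathcal L(LB)=LB$ holds if and only if there is a fractional set cover solution with radius $LB$ that uses at most $p$ sets, i.e., if and only if there is a feasible solution $y^\ast$ of $$\min\ \sum_{j\in J}y_j\quad\text{s.t.}\quad \sum_{j\in J:\,d_{ij}\le LB}y_j\ge 1\ \ \forall i\in I,\qquad 0\le y_j\le 1\ \ \forall j\in J$$ with objective function value at most $p$.
   Context: An instance of the $p$-center problem consists of a finite nonempty set $I$ of customer demand points, a finite nonempty set $J$ of potential facility locations, an integer $p$ with $1\le p\le |J|$, and real distances $d_{ij}\ge 0$ for $i\in I$, $j\in J$. (PC2) is the mixed-integer program: minimize $z$ subject to $\sum_{j\in J}y_j=p$; $z\ge d_{ij}-\sum_{j'\in J:\,d_{ij'}<d_{ij}}(d_{ij}-d_{ij'})y_{j'}$ for all $i\in I$, $j\in J$; $y_j\in\{0,1\}$ for all $j\in J$; $z\in\mathbb R$. For $LB\in\mathbb R$, $\mathcal L(LB)$ denotes the optimal objective function value of the linear program (PCLB): minimize $z$ subject to $\sum_{j\in J}y_j=p$; $z\ge d_{ij}-\sum_{j'\in J:\,d_{ij'}<d_{ij}}(d_{ij}-\max\{LB,d_{ij'}\})y_{j'}$ for all $i\in I$, $j\in J$ with $d_{ij}>LB$; $z\ge LB$; $0\le y_j\le 1$ for all $j\in J$; $z\in\mathbb R$. *)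

theory Defs
  imports Complex_Main
begin

text \<open>
  A vector indexed by the finite set \<open>J\<close> is a function \<open>y :: 'j \<Rightarrow> real\<close>;
  only its values on \<open>J\<close> are ever used. Feasible points are pairs \<open>(y, z)\<close>.
\<close>

definition pc2_feasible ::
  "'i set \<Rightarrow> 'j set \<Rightarrow> nat \<Rightarrow> ('i \<Rightarrow> 'j \<Rightarrow> real) \<Rightarrow> (('j \<Rightarrow> real) \<times> real) set" where
  "pc2_feasible I J p d = {(y, z).
     (\<Sum>j\<in>J. y j) = real p \<and>
     (\<forall>i\<in>I. \<forall>j\<in>J. z \<ge> d i j - (\<Sum>j'\<in>{j'\<in>J. d i j' < d i j}. (d i j - d i j') * y j')) \<and>
     (\<forall>j\<in>J. y j \<in> {0, 1})}"

definition pclb_feasible ::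
  "'i set \<Rightarrow> 'j set \<Rightarrow> nat \<Rightarrow> ('i \<Rightarrow> 'j \<Rightarrow> real) \<Rightarrow> real \<Rightarrow> (('j \<Rightarrow> real) \<times> real) set" where
  "pclb_feasible I J p d LB = {(y, z).
     (\<Sum>j\<in>J. y j) = real p \<and>
     (\<forall>i\<in>I. \<forall>j\<in>J. d i j > LB \<longrightarrow>
        z \<ge> d i j - (\<Sum>j'\<in>{j'\<in>J. d i j' < d i j}. (d i j - max LB (d i j')) * y j')) \<and>
     z \<ge> LB \<and>
     (\<forall>j\<in>J. 0 \<le> y j \<and> y j \<le> 1)}"

text \<open>
  The infimum over the reals is meaningful only for a nonempty family that is bounded
  below; the lemmas at the end of this theory establish this for both programs.
\<close>

definition optimal_value :: "(('j \<Rightarrow> real) \<times> real) set \<Rightarrow> real" where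
  "optimal_value S = (INF (y, z)\<in>S. z)"

definition pc2_value :: "'i set \<Rightarrow> 'j set \<Rightarrow> nat \<Rightarrow> ('i \<Rightarrow> 'j \<Rightarrow> real) \<Rightarrow> real" where
  "pc2_value I J p d = optimal_value (pc2_feasible I J p d)"

definition pclb_value :: "'i set \<Rightarrow> 'j set \<Rightarrow> nat \<Rightarrow> ('i \<Rightarrow> 'j \<Rightarrow> real) \<Rightarrow> real \<Rightarrow> real" where
  "pclb_value I J p d LB = optimal_value (pclb_feasible I J p d LB)"

definition fractional_set_cover ::
  "'i set \<Rightarrow> 'j set \<Rightarrow> ('i \<Rightarrow> 'j \<Rightarrow> real) \<Rightarrow> real \<Rightarrow> ('j \<Rightarrow> real) set" where
  "fractional_set_cover I J d r = {y.
     (\<forall>i\<in>I. (\<Sum>j\<in>{j\<in>J. d i j \<le> r}. y j) \<ge> 1) \<and>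
     (\<forall>j\<in>J. 0 \<le> y j \<and> y j \<le> 1)}"

lemma finite_upper_bound:
  fixes f :: "'i \<Rightarrow> 'j \<Rightarrow> real"
  assumes "finite I" "finite J"
  obtains z where "\<forall>i\<in>I. \<forall>j\<in>J. f i j \<le> z" "c \<le> z"
proof -
  let ?A = "insert c ((\<lambda>(i, j). f i j) ` (I \<times> J))"
  have fin: "finite ?A" using assms by simp
  have "f i j \<le> Max ?A" if "i \<in> I" "j \<in> J" for i j
    using that by (intro Max_ge[OF fin]) force
  moreover have "c \<le> Max ?A" by (intro Max_ge[OF fin]) simp
  ultimately show ?thesis using that by blast
qed

lemma indicator_selection:
  assumes "finite J" "p \<le> card J"
  obtains y :: "'j \<Rightarrow> real" where "(\<Sum>j\<in>J. y j) = real p" "\<And>j. y j \<in> {0, 1}"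
proof -
  obtain K where K: "K \<subseteq> J" "card K = p"
    using obtain_subset_with_card_n[OF assms(2)] by blast
  have "(\<Sum>j\<in>J. if j \<in> K then 1 else 0 :: real) = real (card (J \<inter> K))"
    using assms(1) by (simp add: sum.If_cases)
  also have "J \<inter> K = K" using K by blast
  finally show ?thesis using K that[of "\<lambda>j. if j \<in> K then 1 else 0"] by simp
qed

lemma pc2_feasible_nonempty:
  assumes "finite I" "finite J" "p \<le> card J"
  shows "pc2_feasible I J p d \<noteq> {}"
proof -
  obtain y :: "'b \<Rightarrow> real" where y: "(\<Sum>j\<in>J. y j) = real p" "\<And>j. y j \<in> {0, 1}"
    using indicator_selection[OF assms(2,3)] by blast
  let ?f = "\<lambda>i j. d i j - (\<Sum>j'\<in>{j'\<in>J. d i j' < d i j}. (d i j - d i j') * y j')"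
  obtain z where "\<forall>i\<in>I. \<forall>j\<in>J. ?f i j \<le> z" "0 \<le> z"
    using finite_upper_bound[OF assms(1,2), of ?f 0] by blast
  then have "(y, z) \<in> pc2_feasible I J p d" using y by (simp add: pc2_feasible_def)
  then show ?thesis by blast
qed

lemma pclb_feasible_nonempty:
  assumes "finite I" "finite J" "p \<le> card J"
  shows "pclb_feasible I J p d LB \<noteq> {}"
proof -
  obtain y :: "'b \<Rightarrow> real" where y: "(\<Sum>j\<in>J. y j) = real p" "\<And>j. y j \<in> {0, 1}"
    using indicator_selection[OF assms(2,3)] by blast
  have y01: "0 \<le> y j \<and> y j \<le> 1" for j using y(2)[of j] by auto
  let ?f = "\<lambda>i j. d i j - (\<Sum>j'\<in>{j'\<in>J. d i j' < d i j}. (d i j - max LB (d i j')) * y j')"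
  obtain z where "\<forall>i\<in>I. \<forall>j\<in>J. ?f i j \<le> z" "LB \<le> z"
    using finite_upper_bound[OF assms(1,2), of ?f LB] by blast
  then have "(y, z) \<in> pclb_feasible I J p d LB" using y(1) y01 by (simp add: pclb_feasible_def)
  then show ?thesis by blast
qed

text \<open>
  For fixed \<open>i\<close>, the constraint of a nearest facility \<open>j\<close> has an empty sum, so it
  reads \<open>z \<ge> d i j\<close>.
\<close>

lemma pc2_bdd_below:
  assumes "finite J" "I \<noteq> {}" "J \<noteq> {}"
  shows "bdd_below ((\<lambda>(y, z). z) ` pc2_feasible I J p d)"
proof -
  obtain i where i: "i \<in> I" using assms(2) by blast
  define j where "j = arg_min_on (d i) J"
  have j: "j \<in> J" and none: "{j'\<in>J. d i j' < d i j} = {}"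
    using arg_min_if_finite[OF assms(1,3), of "d i"] by (auto simp: j_def)
  have "d i j \<le> z" if "(y, z) \<in> pc2_feasible I J p d" for y z
  proof -
    have "z \<ge> d i j - (\<Sum>j'\<in>{j'\<in>J. d i j' < d i j}. (d i j - d i j') * y j')"
      using that i j by (simp add: pc2_feasible_def)
    then show ?thesis by (simp only: none sum.empty)
  qed
  then show ?thesis by (intro bdd_belowI[of _ "d i j"]) auto
qed

lemma pclb_bdd_below: "bdd_below ((\<lambda>(y, z). z) ` pclb_feasible I J p d LB)"
  by (auto simp: bdd_below_def pclb_feasible_def)

end

theory Submission
  imports Defs
begin

text \<open>
  The bound \<open>LB\<close> always is a lower bound on (PCLB), and (PCLB) attains its optimum because the
  \<open>y\<close>-part of its feasible set is compact. So the value equals \<open>LB\<close> exactly when some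
  \<open>(y, LB)\<close> is feasible. Such \<open>y\<close> turn out to be the fractional set covers of radius
  \<open>LB\<close> with total weight exactly \<open>p\<close> (\<open>pclb_feasible_at_LB_iff\<close>):
  for a customer \<open>i\<close>, the constraint of the nearest facility \<open>j\<close> beyond \<open>LB\<close> has
  as its sum \<open>d i j - LB\<close> times the weight of the facilities within \<open>LB\<close>, so it is the
  covering constraint of \<open>i\<close> multiplied by \<open>d i j - LB > 0\<close>; the constraints of farther
  facilities follow from it. Finally, a cover of weight at most \<open>p \<le> card J\<close> can be raised
  to weight exactly \<open>p\<close>, since increasing weights keeps every covering constraint satisfied.
\<close>

section \<open>Attainment of the optimum\<close>

text \<open>
  Bolzano-Weierstrass for vectors indexed by a finite set: pass to a further subsequence for one
  coordinate after the other.
\<close>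

lemma bounded_finite_family_convergent_subseq:
  fixes f :: "nat \<Rightarrow> 'j \<Rightarrow> real"
  assumes "finite J" "\<And>j n. j \<in> J \<Longrightarrow> \<bar>f n j\<bar> \<le> B"
  obtains r l where "strict_mono (r :: nat \<Rightarrow> nat)" "\<And>j. j \<in> J \<Longrightarrow> (\<lambda>n. f (r n) j) \<longlonglongrightarrow> l j"
proof -
  have "\<exists>r l. strict_mono (r :: nat \<Rightarrow> nat) \<and> (\<forall>j\<in>J. (\<lambda>n. f (r n) j) \<longlonglongrightarrow> l j)"
    using assms
  proof (induction J rule: finite_induct)
    case empty
    show ?case using strict_mono_id by auto
  next
    case (insert k J)
    then obtain r :: "nat \<Rightarrow> nat" and l where r: "strict_mono r"
      and l: "\<forall>j\<in>J. (\<lambda>n. f (r n) j) \<longlonglongrightarrow> l j"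
      by auto
    obtain s :: "nat \<Rightarrow> nat" where s: "strict_mono s" "monoseq (\<lambda>n. f (r (s n)) k)"
      using seq_monosub[of "\<lambda>n. f (r n) k"] by blast
    have "Bseq (\<lambda>n. f (r (s n)) k)"
      using insert.prems by (intro BseqI'[of _ B]) simp
    then obtain c where c: "(\<lambda>n. f (r (s n)) k) \<longlonglongrightarrow> c"
      using Bseq_monoseq_convergent s(2) by (blast dest: convergentD)
    have "(\<lambda>n. f (r (s n)) j) \<longlonglongrightarrow> (l(k := c)) j" if "j \<in> insert k J" for j
    proof (cases "j = k")
      case False
      then show ?thesis
        using that l LIMSEQ_subseq_LIMSEQ[OF _ s(1), of "\<lambda>n. f (r n) j" "l j"]
        by (auto simp: o_def)
    qed (use c in simp)
    moreover have "strict_mono (r \<circ> s)" using r s(1) by (rule strict_mono_o)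
    ultimately show ?case by (intro exI[of _ "r \<circ> s"] exI[of _ "l(k := c)"]) (simp add: o_def)
  qed
  then show ?thesis using that by blast
qed

text \<open>
  All constraints are non-strict inequalities between expressions continuous in \<open>(y, z)\<close>.
\<close>

lemma pclb_feasible_sequentially_closed:
  assumes "\<And>n. (Y n, Z n) \<in> pclb_feasible I J p d LB"
    and Y: "\<And>j. j \<in> J \<Longrightarrow> (\<lambda>n. Y n j) \<longlonglongrightarrow> y j" and Z: "Z \<longlonglongrightarrow> z"
  shows "(y, z) \<in> pclb_feasible I J p d LB"
proof -
  have feas: "(\<Sum>j\<in>J. Y n j) = real p" "LB \<le> Z n"
    "\<And>j. j \<in> J \<Longrightarrow> 0 \<le> Y n j" "\<And>j. j \<in> J \<Longrightarrow> Y n j \<le> 1"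
    "\<And>i j. i \<in> I \<Longrightarrow> j \<in> J \<Longrightarrow> d i j > LB \<Longrightarrow>
      d i j - (\<Sum>j'\<in>{j'\<in>J. d i j' < d i j}. (d i j - max LB (d i j')) * Y n j') \<le> Z n" for n
    using assms(1)[of n] by (auto simp: pclb_feasible_def)
  have "(\<lambda>n. \<Sum>j\<in>J. Y n j) \<longlonglongrightarrow> (\<Sum>j\<in>J. y j)"
    by (intro tendsto_sum Y)
  then have "(\<Sum>j\<in>J. y j) = real p"
    by (simp add: feas LIMSEQ_const_iff)
  moreover have "LB \<le> z"
    using LIMSEQ_le_const[OF Z] feas by blast
  moreover have "0 \<le> y j \<and> y j \<le> 1" if "j \<in> J" for j
    using LIMSEQ_le_const[OF Y] LIMSEQ_le_const2[OF Y] feas that by blast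
  moreover have "d i j - (\<Sum>j'\<in>{j'\<in>J. d i j' < d i j}. (d i j - max LB (d i j')) * y j') \<le> z"
    if "i \<in> I" "j \<in> J" "d i j > LB" for i j
  proof (rule LIMSEQ_le[OF _ Z])
    show "(\<lambda>n. d i j - (\<Sum>j'\<in>{j'\<in>J. d i j' < d i j}. (d i j - max LB (d i j')) * Y n j'))
      \<longlonglongrightarrow> d i j - (\<Sum>j'\<in>{j'\<in>J. d i j' < d i j}. (d i j - max LB (d i j')) * y j')"
      by (intro tendsto_intros Y) auto
  qed (use feas that in blast)
  ultimately show ?thesis by (simp add: pclb_feasible_def)
qed

lemma pclb_value_attained:
  assumes "finite I" "finite J" "p \<le> card J"
  shows "\<exists>y. (y, pclb_value I J p d LB) \<in> pclb_feasible I J p d LB"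
proof -
  let ?F = "pclb_feasible I J p d LB" and ?v = "pclb_value I J p d LB"
  have "\<exists>y z. (y, z) \<in> ?F \<and> z < ?v + 1 / real (Suc n)" for n
  proof -
    have "Inf ((\<lambda>(y, z). z) ` ?F) < ?v + 1 / real (Suc n)"
      by (simp add: pclb_value_def optimal_value_def)
    then show ?thesis
      using cInf_lessD[of "(\<lambda>(y, z). z) ` ?F"] pclb_feasible_nonempty[OF assms] by force
  qed
  then obtain Y Z where YZ: "\<And>n. (Y n, Z n) \<in> ?F" "\<And>n. Z n < ?v + 1 / real (Suc n)"
    by metis
  have lower: "?v \<le> Z n" for n
    unfolding pclb_value_def optimal_value_def
    using cINF_lower[OF pclb_bdd_below YZ(1)[of n]] by simp
  have Z: "Z \<longlonglongrightarrow> ?v"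
  proof (rule tendsto_sandwich[of "\<lambda>_. ?v" Z])
    show "(\<lambda>n. ?v + 1 / real (Suc n)) \<longlonglongrightarrow> ?v"
      using LIMSEQ_inverse_real_of_nat_add[of ?v] by (simp add: inverse_eq_divide)
  qed (use lower YZ(2) in \<open>auto intro!: always_eventually less_imp_le\<close>)
  have "\<bar>Y n j\<bar> \<le> 1" if "j \<in> J" for n j
    using YZ(1)[of n] that by (auto simp: pclb_feasible_def)
  then obtain r :: "nat \<Rightarrow> nat" and y where
    r: "strict_mono r" and y: "\<And>j. j \<in> J \<Longrightarrow> (\<lambda>n. Y (r n) j) \<longlonglongrightarrow> y j"
    using bounded_finite_family_convergent_subseq[OF assms(2), of Y 1] by blast
  have "(y, ?v) \<in> ?F"
  proof (rule pclb_feasible_sequentially_closed)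
    show "(Y (r n), Z (r n)) \<in> ?F" for n by (rule YZ(1))
  qed (use y LIMSEQ_subseq_LIMSEQ[OF Z r] in \<open>auto simp: o_def\<close>)
  then show ?thesis by blast
qed

lemma pclb_value_eq_LB_iff:
  assumes "finite I" "finite J" "p \<le> card J"
  shows "pclb_value I J p d LB = LB \<longleftrightarrow> (\<exists>y. (y, LB) \<in> pclb_feasible I J p d LB)"
proof
  assume "\<exists>y. (y, LB) \<in> pclb_feasible I J p d LB"
  then obtain y where y: "(y, LB) \<in> pclb_feasible I J p d LB" by blast
  have "pclb_value I J p d LB \<le> LB"
    unfolding pclb_value_def optimal_value_def
    using cINF_lower[OF pclb_bdd_below y] by simp
  moreover have "LB \<le> pclb_value I J p d LB"
    using pclb_value_attained[OF assms, of d LB] by (auto simp: pclb_feasible_def)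
  ultimately show "pclb_value I J p d LB = LB" by simp
qed (use pclb_value_attained[OF assms, of d LB] in auto)

section \<open>Feasibility at the bound and fractional covers\<close>

lemma pclb_feasible_at_LB_covers:
  assumes "finite J" "1 \<le> p" "(y, LB) \<in> pclb_feasible I J p d LB" "i \<in> I"
  shows "1 \<le> (\<Sum>j\<in>{j\<in>J. d i j \<le> LB}. y j)"
proof (cases "\<exists>j\<in>J. d i j > LB")
  case False
  then have "{j\<in>J. d i j \<le> LB} = J" by force
  then show ?thesis using assms(2,3) by (simp add: pclb_feasible_def)
next
  case True
  let ?c = "\<Sum>j\<in>{j\<in>J. d i j \<le> LB}. y j"
  define j where "j = arg_min_on (d i) {j\<in>J. d i j > LB}"
  have min: "finite {j\<in>J. d i j > LB}" "{j\<in>J. d i j > LB} \<noteq> {}" using True assms(1) by auto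
  have j: "j \<in> J" "d i j > LB"
    using arg_min_if_finite(1)[OF min, of "d i"] by (simp_all add: j_def)
  have nearest: "d i j \<le> d i j'" if "j' \<in> J" "d i j' > LB" for j'
    using arg_min_least[OF min, of j' "d i"] that by (simp add: j_def)
  have closer: "{j'\<in>J. d i j' < d i j} = {j'\<in>J. d i j' \<le> LB}"
    using j(2) nearest by force
  have "d i j - (\<Sum>j'\<in>{j'\<in>J. d i j' < d i j}. (d i j - max LB (d i j')) * y j') \<le> LB"
    using assms(3,4) j by (simp add: pclb_feasible_def)
  also have "(\<Sum>j'\<in>{j'\<in>J. d i j' < d i j}. (d i j - max LB (d i j')) * y j') = (d i j - LB) * ?c"
    unfolding closer sum_distrib_left by (intro sum.cong) (auto simp: max_def)
  finally have "(d i j - LB) * 1 \<le> (d i j - LB) * ?c" by simp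
  then show ?thesis using j(2) by (simp only: mult_le_cancel_left_pos diff_gt_0_iff_gt)
qed

text \<open>
  Keep only the facilities within \<open>LB\<close> in the sum: the discarded terms are nonnegative, and the
  remaining ones add up to at least \<open>d i j - LB\<close> by the covering constraint.
\<close>

lemma covered_customer_pclb_constraint:
  assumes "finite J" "\<And>j. j \<in> J \<Longrightarrow> 0 \<le> y j" "1 \<le> (\<Sum>j\<in>{j\<in>J. d i j \<le> LB}. y j)" "LB < d i j"
  shows "d i j - (\<Sum>j'\<in>{j'\<in>J. d i j' < d i j}. (d i j - max LB (d i j')) * y j') \<le> (LB :: real)"
proof -
  have "(d i j - LB) * 1 \<le> (d i j - LB) * (\<Sum>j'\<in>{j'\<in>J. d i j' \<le> LB}. y j')"
    using assms(3,4) by (intro mult_left_mono) auto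
  also have "\<dots> = (\<Sum>j'\<in>{j'\<in>J. d i j' \<le> LB}. (d i j - max LB (d i j')) * y j')"
    unfolding sum_distrib_left by (intro sum.cong) (auto simp: max_def)
  also have "\<dots> \<le> (\<Sum>j'\<in>{j'\<in>J. d i j' < d i j}. (d i j - max LB (d i j')) * y j')"
    using assms by (intro sum_mono2) auto
  finally show ?thesis by simp
qed

lemma pclb_feasible_at_LB_iff:
  assumes "finite J" "1 \<le> p"
  shows "(y, LB) \<in> pclb_feasible I J p d LB \<longleftrightarrow>
    y \<in> fractional_set_cover I J d LB \<and> (\<Sum>j\<in>J. y j) = real p"
proof
  assume feas: "(y, LB) \<in> pclb_feasible I J p d LB"
  then show "y \<in> fractional_set_cover I J d LB \<and> (\<Sum>j\<in>J. y j) = real p"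
    using pclb_feasible_at_LB_covers[OF assms feas]
    by (auto simp: fractional_set_cover_def pclb_feasible_def)
next
  assume "y \<in> fractional_set_cover I J d LB \<and> (\<Sum>j\<in>J. y j) = real p"
  then show "(y, LB) \<in> pclb_feasible I J p d LB"
    using covered_customer_pclb_constraint[OF assms(1), of y d _ LB]
    by (auto simp: fractional_set_cover_def pclb_feasible_def)
qed

text \<open>
  Moving from \<open>y\<close> towards the all-ones vector increases the total weight continuously up to
  \<open>card J\<close>, stays in the unit cube and only helps the covering constraints.
\<close>

lemma fractional_set_cover_extend:
  assumes "finite J" "p \<le> card J" "y \<in> fractional_set_cover I J d r" "(\<Sum>j\<in>J. y j) \<le> real p"
  obtains y' where "y' \<in> fractional_set_cover I J d r" "(\<Sum>j\<in>J. y' j) = real p"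
proof -
  let ?s = "\<Sum>j\<in>J. y j"
  \<comment> \<open>If \<open>?s = card J\<close>, then \<open>?s = p\<close> already, and the division by zero gives the
    desired step length \<open>0\<close>.\<close>
  define t where "t = (real p - ?s) / (real (card J) - ?s)"
  define y' where "y' j = y j + t * (1 - y j)" for j
  have y01: "0 \<le> y j" "y j \<le> 1" if "j \<in> J" for j
    using assms(3) that by (auto simp: fractional_set_cover_def)
  have t: "0 \<le> t" "t \<le> 1" using assms(2,4) by (auto simp: t_def divide_le_eq_1)
  have ge: "y j \<le> y' j" and le1: "y' j \<le> 1" if "j \<in> J" for j
  proof -
    show "y j \<le> y' j" using y01[OF that] t by (simp add: y'_def)
    show "y' j \<le> 1"
      using y01[OF that] t mult_right_mono[of t 1 "1 - y j"] by (simp add: y'_def)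
  qed
  have "1 \<le> (\<Sum>j\<in>{j\<in>J. d i j \<le> r}. y' j)" if "i \<in> I" for i
  proof -
    have "1 \<le> (\<Sum>j\<in>{j\<in>J. d i j \<le> r}. y j)"
      using assms(3) that by (simp add: fractional_set_cover_def)
    also have "\<dots> \<le> (\<Sum>j\<in>{j\<in>J. d i j \<le> r}. y' j)" by (intro sum_mono) (simp add: ge)
    finally show ?thesis .
  qed
  then have "y' \<in> fractional_set_cover I J d r"
    using y01 ge le1 by (force simp: fractional_set_cover_def)
  moreover have "(\<Sum>j\<in>J. y' j) = ?s + t * (real (card J) - ?s)"
    by (simp add: y'_def sum.distrib sum_subtractf flip: sum_distrib_left)
  then have "(\<Sum>j\<in>J. y' j) = real p"
    using assms(2,4) by (cases "real (card J) = ?s") (auto simp: t_def)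
  ultimately show ?thesis using that by blast
qed

section \<open>When the bound equals the optimum\<close>

theorem theorem9:
  fixes I :: "'i set" and J :: "'j set" and p :: nat
    and d :: "'i \<Rightarrow> 'j \<Rightarrow> real" and LB :: real
  assumes "finite I" and "I \<noteq> {}"
    and "finite J" and "J \<noteq> {}"
    and "1 \<le> p" and "p \<le> card J"
    and "\<And>i j. i \<in> I \<Longrightarrow> j \<in> J \<Longrightarrow> d i j \<ge> 0"
    and "LB \<ge> 0"
    and "LB \<le> pc2_value I J p d"
  shows "pclb_value I J p d LB = LB \<longleftrightarrow>
    (\<exists>y\<in>fractional_set_cover I J d LB. (\<Sum>j\<in>J. y j) \<le> real p)"
proof -
  have "pclb_value I J p d LB = LB \<longleftrightarrow>
    (\<exists>y\<in>fractional_set_cover I J d LB. (\<Sum>j\<in>J. y j) = real p)"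
    using pclb_value_eq_LB_iff[OF assms(1,3,6)] pclb_feasible_at_LB_iff[OF assms(3,5)] by blast
  also have "\<dots> \<longleftrightarrow> (\<exists>y\<in>fractional_set_cover I J d LB. (\<Sum>j\<in>J. y j) \<le> real p)"
    using fractional_set_cover_extend[OF assms(3,6)] by (metis order_refl)
  finally show ?thesis .
qed

end
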